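(* (Chain Rule) Let $f:m_{\approx}(I)\to\widehat{\mathbb{R}}$, $g:m_{\approx}(J)\to\widehat{\mathbb{R}}$ be indiscernible extensions of $\phi:I\to\mathbb{R}$, $\psi:J\to\mathbb{R}$, respectively, where $I,J$ are open intervals in $\mathbb{R}$ such that $\phi(I)\subseteq J$, and let $\xi_0\in I$. If $f$ is differentiable at $\xi_0$, $g$ is differentiable at $\eta_0:=f(\xi_0)$, and both $\lim_{\xi\to\xi_0}\frac{\phi(\xi)-\phi(\xi_0)}{\xi-\xi_0}$ and $\lim_{\eta\to\eta_0}\frac{\psi(\eta)-\psi(\eta_0)}{\eta-\eta_0}$ exist in $\mathbb{R}$, then $g\circ f$ is differentiable at $\xi_0$, and for each $x\in m_{\approx}(\xi_0)$: $$(g\circ f)'(x)=g'(f(x))\,f'(x).$$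
   Context: $\widehat{\mathbb{R}}$ is the set of all convergent sequences of real numbers; a real number is identified with the corresponding constant sequence, so $\mathbb{R}\subseteq\widehat{\mathbb{R}}$. $\sigma x\in\mathbb{R}$ is the limit of $x$; $x\approx y$ means $\sigma x=\sigma y$; $dx:=x-\sigma x$. For $x=(\xi_n),y=(\eta_n)$: $x+y:=(\xi_n+\eta_n)$, $xy:=(\sigma x\,\eta_n+\sigma y\,\xi_n-\sigma x\,\sigma y)$. $m_{\approx}(x):=\{y\in\widehat{\mathbb{R}}\mid y\approx x\}$ and $m_{\approx}(A):=\bigcup_{x\in A}m_{\approx}(x)$ for $A\subseteq\widehat{\mathbb{R}}$. A function $f:m_{\approx}(I)\to\widehat{\mathbb{R}}$ is an indiscernible extension of $\phi:I\to\mathbb{R}$ iff $f(\sigma x)=\phi(\sigma x)$ and $f(x)\approx\phi(\sigma x)$ for all $x\in m_{\approx}(I)$. Such an $f$ is differentiable at $\xi_0\in I$ iff there is a real number $\alpha$ with $f(x)=\phi(\xi_0)+\alpha\,dx$ for all $x\in m_{\approx}(\xi_0)$, with the proviso that $\alpha=\lim_{\xi\to\xi_0}\frac{\phi(\xi)-\phi(\xi_0)}{\xi-\xi_0}$ whenever this (usual) limit exists in $\mathbb{R}$. This $\alpha$ is unique and, for each $x\in m_{\approx}(\xi_0)$, it is called the derivative of $f$ at $x$ and denoted $f'(x)$. The composite $g\circ f$ is regarded as an indiscernible extension of $\psi\circ\phi:I\to\mathbb{R}$. *)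

theory Defs
  imports "HOL-Analysis.Analysis"
begin

typedef rhat = "{X :: nat \<Rightarrow> real. convergent X}"
  morphisms seq Abs_rhat
  by (auto intro: convergent_const)

setup_lifting type_definition_rhat

text \<open>The identification of a real number with a constant sequence.\<close>

lift_definition hat :: "real \<Rightarrow> rhat" is "\<lambda>r n. r"
  by (rule convergent_const)

definition \<sigma> :: "rhat \<Rightarrow> real" where
  "\<sigma> x = lim (seq x)"

text \<open>
  The product is not the pointwise one: the term in which both factors deviate from their
  limits is dropped, so that \<open>dx * dy = 0\<close>. Subtraction is pointwise; it is
  \<open>x + hat (-1) * y\<close> for this product.
\<close>

instantiation rhat :: comm_ring_1
begin

lift_definition zero_rhat :: rhat is "\<lambda>n. 0" by (rule convergent_const)

lift_definition one_rhat :: rhat is "\<lambda>n. 1" by (rule convergent_const)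

lift_definition plus_rhat :: "rhat \<Rightarrow> rhat \<Rightarrow> rhat" is "\<lambda>X Y n. X n + Y n"
  by (rule convergent_add)

lift_definition uminus_rhat :: "rhat \<Rightarrow> rhat" is "\<lambda>X n. - X n"
  by (simp add: convergent_minus_iff [symmetric])

lift_definition minus_rhat :: "rhat \<Rightarrow> rhat \<Rightarrow> rhat" is "\<lambda>X Y n. X n - Y n"
  by (rule convergent_diff)

lift_definition times_rhat :: "rhat \<Rightarrow> rhat \<Rightarrow> rhat"
  is "\<lambda>X Y n. lim X * Y n + lim Y * X n - lim X * lim Y"
  by (intro convergent_add convergent_diff convergent_mult convergent_const)

instance
proof -
  have lim_times: "lim (\<lambda>n. lim X * Y n + lim Y * X n - lim X * lim Y) = lim X * lim Y"
    if "convergent X" "convergent Y" for X Y :: "nat \<Rightarrow> real"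
  proof (rule limI)
    have "X \<longlonglongrightarrow> lim X" "Y \<longlonglongrightarrow> lim Y"
      using that by (simp_all add: convergent_LIMSEQ_iff)
    then have "(\<lambda>n. lim X * Y n + lim Y * X n - lim X * lim Y)
        \<longlonglongrightarrow> lim X * lim Y + lim Y * lim X - lim X * lim Y"
      by (intro tendsto_intros)
    then show "(\<lambda>n. lim X * Y n + lim Y * X n - lim X * lim Y) \<longlonglongrightarrow> lim X * lim Y"
      by (simp add: mult.commute)
  qed
  have lim_plus: "lim (\<lambda>n. X n + Y n) = lim X + lim Y"
    if "convergent X" "convergent Y" for X Y :: "nat \<Rightarrow> real"
    using that by (intro limI tendsto_add) (simp_all add: convergent_LIMSEQ_iff)
  show "OFCLASS(rhat, comm_ring_1_class)"
  proof
    fix a b c :: rhat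
    show "a * b * c = a * (b * c)"
      by transfer (simp add: lim_times, simp add: algebra_simps)
    show "a * b = b * a"
      by transfer (simp add: algebra_simps)
    show "1 * a = a"
      by transfer simp
    show "(a + b) * c = a * c + b * c"
      by transfer (simp add: lim_plus, simp add: algebra_simps)
  qed (transfer; simp add: algebra_simps fun_eq_iff)+
qed

end

lemma \<sigma>_hat [simp]: "\<sigma> (hat r) = r"
  unfolding \<sigma>_def by transfer simp

lemma hat_add: "hat (r + s) = hat r + hat s"
  by transfer simp

lemma hat_mult: "hat (r * s) = hat r * hat s"
  by transfer (simp add: algebra_simps)

no_notation eqpoll (infixl "\<approx>" 50)

definition indisc :: "rhat \<Rightarrow> rhat \<Rightarrow> bool"  (infix "\<approx>" 50) where
  "x \<approx> y \<longleftrightarrow> \<sigma> x = \<sigma> y"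

definition d :: "rhat \<Rightarrow> rhat" where
  "d x = x - hat (\<sigma> x)"

definition monad :: "rhat \<Rightarrow> rhat set" where
  "monad x = {y. y \<approx> x}"

definition monads :: "rhat set \<Rightarrow> rhat set" where
  "monads A = (\<Union>x\<in>A. monad x)"

text \<open>
  Functions with domain \<open>I\<close> or \<open>monads (hat ` I)\<close> are represented by total functions, of which
  only the values on that domain are ever constrained.
\<close>

definition indisc_extension :: "real set \<Rightarrow> (real \<Rightarrow> real) \<Rightarrow> (rhat \<Rightarrow> rhat) \<Rightarrow> bool" where
  "indisc_extension I \<phi> f \<longleftrightarrow>
     (\<forall>x \<in> monads (hat ` I). f (hat (\<sigma> x)) = hat (\<phi> (\<sigma> x)) \<and> f x \<approx> hat (\<phi> (\<sigma> x)))"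

text \<open>
  The limit is taken within \<open>I\<close>, the domain of \<open>\<phi>\<close>; for open \<open>I\<close> this is the usual
  two-sided limit.
\<close>

definition has_diff_quotient_limit ::
    "real set \<Rightarrow> (real \<Rightarrow> real) \<Rightarrow> real \<Rightarrow> real \<Rightarrow> bool" where
  "has_diff_quotient_limit I \<phi> \<xi>\<^sub>0 l \<longleftrightarrow>
     ((\<lambda>\<xi>. (\<phi> \<xi> - \<phi> \<xi>\<^sub>0) / (\<xi> - \<xi>\<^sub>0)) \<longlongrightarrow> l) (at \<xi>\<^sub>0 within I)"

definition has_hat_derivative ::
    "real set \<Rightarrow> (real \<Rightarrow> real) \<Rightarrow> (rhat \<Rightarrow> rhat) \<Rightarrow> real \<Rightarrow> real \<Rightarrow> bool" where
  "has_hat_derivative I \<phi> f \<xi>\<^sub>0 \<alpha> \<longleftrightarrow>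
     indisc_extension I \<phi> f \<and> \<xi>\<^sub>0 \<in> I \<and>
     (\<forall>x \<in> monad (hat \<xi>\<^sub>0). f x = hat (\<phi> \<xi>\<^sub>0) + hat \<alpha> * d x) \<and>
     (\<forall>l. has_diff_quotient_limit I \<phi> \<xi>\<^sub>0 l \<longrightarrow> \<alpha> = l)"

definition hat_differentiable ::
    "real set \<Rightarrow> (real \<Rightarrow> real) \<Rightarrow> (rhat \<Rightarrow> rhat) \<Rightarrow> real \<Rightarrow> bool" where
  "hat_differentiable I \<phi> f \<xi>\<^sub>0 \<longleftrightarrow> (\<exists>\<alpha>. has_hat_derivative I \<phi> f \<xi>\<^sub>0 \<alpha>)"

text \<open>
  The derivative at a point \<open>x\<close> of the monad of \<open>\<xi>\<^sub>0\<close>, where \<open>\<xi>\<^sub>0 = \<sigma> x\<close>.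
\<close>

definition hat_deriv ::
    "real set \<Rightarrow> (real \<Rightarrow> real) \<Rightarrow> (rhat \<Rightarrow> rhat) \<Rightarrow> rhat \<Rightarrow> real" where
  "hat_deriv I \<phi> f x = (THE \<alpha>. has_hat_derivative I \<phi> f (\<sigma> x) \<alpha>)"

lemma has_hat_derivative_unique:
  assumes "has_hat_derivative I \<phi> f \<xi>\<^sub>0 \<alpha>" "has_hat_derivative I \<phi> f \<xi>\<^sub>0 \<beta>"
  shows "\<alpha> = \<beta>"
proof -
  define X :: "nat \<Rightarrow> real" where "X = (\<lambda>n. \<xi>\<^sub>0 + inverse (real (Suc n)))"
  have X: "X \<longlonglongrightarrow> \<xi>\<^sub>0"
    unfolding X_def by (rule LIMSEQ_inverse_real_of_nat_add)
  define x where "x = Abs_rhat X"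
  have seq: "seq x = X"
    using X unfolding x_def by (intro Abs_rhat_inverse) (auto simp: convergent_def)
  then have \<sigma>: "\<sigma> x = \<xi>\<^sub>0"
    using X by (simp add: \<sigma>_def limI)
  then have "x \<in> monad (hat \<xi>\<^sub>0)"
    by (simp add: monad_def indisc_def)
  then have "hat \<alpha> * d x = hat \<beta> * d x"
    using assms unfolding has_hat_derivative_def by (metis add_left_cancel)
  moreover have "seq (hat \<gamma> * d x) 0 = \<gamma>" for \<gamma>
  proof -
    have "(\<lambda>n. X n - \<xi>\<^sub>0) \<longlonglongrightarrow> 0"
      using X by (simp add: LIM_zero)
    then have "lim (\<lambda>n. X n - \<xi>\<^sub>0) = 0"
      by (rule limI)
    then show ?thesis
      by (simp add: times_rhat.rep_eq minus_rhat.rep_eq hat.rep_eq d_def \<sigma> seq)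
        (simp add: X_def)
  qed
  ultimately show ?thesis
    by metis
qed

lemma hat_deriv_eqI:
  assumes "has_hat_derivative I \<phi> f (\<sigma> x) \<alpha>"
  shows "hat_deriv I \<phi> f x = \<alpha>"
  unfolding hat_deriv_def using assms has_hat_derivative_unique by blast

end

theory Submission
  imports Defs
begin

text \<open>
  Since \<open>dx * dy = 0\<close>, the differential \<open>d\<close> is linear over the reals and vanishes on them, so
  \<open>f x = \<phi> \<xi>\<^sub>0 + \<alpha> * dx\<close> gives \<open>d (f x) = \<alpha> * dx\<close>; substituting this into
  \<open>g y = \<psi> \<eta>\<^sub>0 + \<beta> * dy\<close> yields the slope \<open>\<beta> * \<alpha>\<close>. The existence of both limits forces
  \<open>\<alpha>\<close> and \<open>\<beta>\<close> to be the classical derivatives, and the classical chain rule then verifies the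
  proviso for the composite.
\<close>

lemma seq_tendsto_\<sigma>: "seq x \<longlonglongrightarrow> \<sigma> x"
  using seq[of x] by (simp add: \<sigma>_def convergent_LIMSEQ_iff)

lemma \<sigma>_add: "\<sigma> (x + y) = \<sigma> x + \<sigma> y"
  using tendsto_add[OF seq_tendsto_\<sigma> seq_tendsto_\<sigma>, of x y]
  by (simp add: \<sigma>_def[of "x + y"] plus_rhat.rep_eq limI)

text \<open>The product differs from the pointwise one only by the product of the deviations of the
  factors from their limits, which is a null sequence.\<close>

lemma \<sigma>_mult: "\<sigma> (x * y) = \<sigma> x * \<sigma> y"
proof -
  have "seq (x * y) = (\<lambda>n. \<sigma> x * seq y n + \<sigma> y * seq x n - \<sigma> x * \<sigma> y)"
    by (simp add: times_rhat.rep_eq \<sigma>_def)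
  moreover have "\<dots> \<longlonglongrightarrow> \<sigma> x * \<sigma> y + \<sigma> y * \<sigma> x - \<sigma> x * \<sigma> y"
    by (intro tendsto_intros seq_tendsto_\<sigma>)
  ultimately show ?thesis
    by (simp add: \<sigma>_def[of "x * y"] limI mult.commute)
qed

lemma \<sigma>_d [simp]: "\<sigma> (d x) = 0"
  using \<sigma>_add[of "d x" "hat (\<sigma> x)"] by (simp add: d_def)

lemma \<sigma>_affine: "\<sigma> (hat a + hat \<alpha> * d x) = a"
  by (simp add: \<sigma>_add \<sigma>_mult)

text \<open>The product \<open>hat \<alpha> * d x\<close> has limit 0, so subtracting the limit
  removes exactly the constant \<open>hat a\<close>.\<close>

lemma d_affine: "d (hat a + hat \<alpha> * d x) = hat \<alpha> * d x"
  by (simp add: d_def[of "hat a + _"] \<sigma>_affine)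

lemma mem_monad_hat: "x \<in> monad (hat r) \<longleftrightarrow> \<sigma> x = r"
  by (simp add: monad_def indisc_def)

text \<open>Membership in the union of the monads over I depends only on the limit, so the domain
  becomes the condition \<open>\<sigma> x \<in> I\<close>.\<close>

lemma indisc_extension_iff:
  "indisc_extension I \<phi> f \<longleftrightarrow>
     (\<forall>x. \<sigma> x \<in> I \<longrightarrow> f (hat (\<sigma> x)) = hat (\<phi> (\<sigma> x)) \<and> \<sigma> (f x) = \<phi> (\<sigma> x))"
  by (auto simp: indisc_extension_def monads_def mem_monad_hat indisc_def)

lemma indisc_extension_comp:
  assumes f: "indisc_extension I \<phi> f" and g: "indisc_extension J \<psi> g" and "\<phi> ` I \<subseteq> J"
  shows "indisc_extension I (\<psi> \<circ> \<phi>) (g \<circ> f)"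
  unfolding indisc_extension_iff
proof (intro allI impI)
  fix x assume "\<sigma> x \<in> I"
  with f \<open>\<phi> ` I \<subseteq> J\<close> have fx: "f (hat (\<sigma> x)) = hat (\<phi> (\<sigma> x))" "\<sigma> (f x) = \<phi> (\<sigma> x)" "\<phi> (\<sigma> x) \<in> J"
    by (auto simp: indisc_extension_iff)
  \<comment> \<open>Taken at \<open>f x\<close>, the property of g yields both halves at once, since
    \<open>f (hat (\<sigma> x))\<close> equals \<open>hat (\<sigma> (f x))\<close>.\<close>
  then have "g (hat (\<sigma> (f x))) = hat (\<psi> (\<sigma> (f x))) \<and> \<sigma> (g (f x)) = \<psi> (\<sigma> (f x))"
    using g unfolding indisc_extension_iff by metis
  with fx show "(g \<circ> f) (hat (\<sigma> x)) = hat ((\<psi> \<circ> \<phi>) (\<sigma> x)) \<and> \<sigma> ((g \<circ> f) x) = (\<psi> \<circ> \<phi>) (\<sigma> x)"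
    by simp
qed

lemma has_diff_quotient_limit_iff:
  "has_diff_quotient_limit I \<phi> \<xi> l \<longleftrightarrow> (\<phi> has_field_derivative l) (at \<xi> within I)"
  unfolding has_diff_quotient_limit_def has_field_derivative_iff ..

text \<open>This is the classical chain rule; the limit within J is first restricted to the image of
  I under \<phi>, the only set that the inner function reaches.\<close>

lemma has_diff_quotient_limit_comp:
  assumes "has_diff_quotient_limit I \<phi> \<xi> \<alpha>" and "has_diff_quotient_limit J \<psi> (\<phi> \<xi>) \<beta>"
    and "\<phi> ` I \<subseteq> J"
  shows "has_diff_quotient_limit I (\<psi> \<circ> \<phi>) \<xi> (\<beta> * \<alpha>)"
  using DERIV_image_chain[of \<psi> \<beta> \<phi> \<xi> I \<alpha>] DERIV_subset[of \<psi> \<beta> "\<phi> \<xi>" J "\<phi> ` I"] assms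
  by (simp add: has_diff_quotient_limit_iff)

text \<open>Openness turns the limit within I into a two-sided one, where derivatives are
  unique.\<close>

lemma has_diff_quotient_limit_unique:
  assumes "open I" "\<xi> \<in> I" "has_diff_quotient_limit I \<phi> \<xi> l" "has_diff_quotient_limit I \<phi> \<xi> m"
  shows "l = m"
  using assms(3,4) DERIV_unique[of \<phi> l \<xi> m]
  by (simp add: has_diff_quotient_limit_iff at_within_open[OF assms(2,1)])

text \<open>The proviso in the definition identifies \<alpha> with whatever limit exists.\<close>

lemma has_hat_derivative_imp_limit:
  assumes "has_hat_derivative I \<phi> f \<xi> \<alpha>" and "\<exists>l. has_diff_quotient_limit I \<phi> \<xi> l"
  shows "has_diff_quotient_limit I \<phi> \<xi> \<alpha>"
  using assms unfolding has_hat_derivative_def by metis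

lemma has_hat_derivative_comp:
  assumes "open I" and "\<phi> ` I \<subseteq> J"
    and f: "has_hat_derivative I \<phi> f \<xi> \<alpha>" and g: "has_hat_derivative J \<psi> g (\<phi> \<xi>) \<beta>"
    and limits: "\<exists>l. has_diff_quotient_limit I \<phi> \<xi> l" "\<exists>l. has_diff_quotient_limit J \<psi> (\<phi> \<xi>) l"
  shows "has_hat_derivative I (\<psi> \<circ> \<phi>) (g \<circ> f) \<xi> (\<beta> * \<alpha>)"
  unfolding has_hat_derivative_def
proof (intro conjI ballI allI impI)
  show "indisc_extension I (\<psi> \<circ> \<phi>) (g \<circ> f)"
    using f g \<open>\<phi> ` I \<subseteq> J\<close> unfolding has_hat_derivative_def by (blast intro: indisc_extension_comp)
  show "\<xi> \<in> I"
    using f by (simp add: has_hat_derivative_def)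
  show "(g \<circ> f) x = hat ((\<psi> \<circ> \<phi>) \<xi>) + hat (\<beta> * \<alpha>) * d x" if "x \<in> monad (hat \<xi>)" for x
  proof -
    have fx: "f x = hat (\<phi> \<xi>) + hat \<alpha> * d x"
      using f that by (simp add: has_hat_derivative_def)
    then have "f x \<in> monad (hat (\<phi> \<xi>))"
      by (simp add: mem_monad_hat \<sigma>_affine)
    then have "g (f x) = hat (\<psi> (\<phi> \<xi>)) + hat \<beta> * d (f x)"
      using g by (simp add: has_hat_derivative_def)
    then show ?thesis
      by (simp add: fx d_affine hat_mult mult.assoc)
  qed
  show "\<beta> * \<alpha> = l" if "has_diff_quotient_limit I (\<psi> \<circ> \<phi>) \<xi> l" for l
    \<comment> \<open>The classical chain rule exhibits \<open>\<beta> * \<alpha>\<close> as a limit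
      of the quotient of the composite, so any limit \<open>l\<close> must agree with it.\<close>
    using has_diff_quotient_limit_unique[OF \<open>open I\<close> \<open>\<xi> \<in> I\<close>
        has_diff_quotient_limit_comp[OF has_hat_derivative_imp_limit[OF f limits(1)]
          has_hat_derivative_imp_limit[OF g limits(2)] \<open>\<phi> ` I \<subseteq> J\<close>] that] .
qed

theorem theorem5p23:
  fixes I J :: "real set" and \<phi> \<psi> :: "real \<Rightarrow> real" and f g :: "rhat \<Rightarrow> rhat"
    and \<xi>\<^sub>0 \<eta>\<^sub>0 :: real
  assumes "open I" "is_interval I" "open J" "is_interval J"
    and "indisc_extension I \<phi> f" and "indisc_extension J \<psi> g"
    and "\<phi> ` I \<subseteq> J"
    and "\<xi>\<^sub>0 \<in> I" and "hat \<eta>\<^sub>0 = f (hat \<xi>\<^sub>0)"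
    and "hat_differentiable I \<phi> f \<xi>\<^sub>0" and "hat_differentiable J \<psi> g \<eta>\<^sub>0"
    and "\<exists>l. has_diff_quotient_limit I \<phi> \<xi>\<^sub>0 l"
    and "\<exists>l. has_diff_quotient_limit J \<psi> \<eta>\<^sub>0 l"
  shows "hat_differentiable I (\<psi> \<circ> \<phi>) (g \<circ> f) \<xi>\<^sub>0 \<and>
    (\<forall>x \<in> monad (hat \<xi>\<^sub>0).
       hat_deriv I (\<psi> \<circ> \<phi>) (g \<circ> f) x = hat_deriv J \<psi> g (f x) * hat_deriv I \<phi> f x)"
proof -
  obtain \<alpha> \<beta> where f: "has_hat_derivative I \<phi> f \<xi>\<^sub>0 \<alpha>" and g: "has_hat_derivative J \<psi> g \<eta>\<^sub>0 \<beta>"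
    using assms(10,11) by (auto simp: hat_differentiable_def)
  have \<sigma>_f: "\<sigma> (f x) = \<phi> \<xi>\<^sub>0" if "\<sigma> x = \<xi>\<^sub>0" for x
    using assms(5,8) that by (auto simp: indisc_extension_iff)
  \<comment> \<open>Apply \<sigma> to both sides of
    \<open>hat \<eta>\<^sub>0 = f (hat \<xi>\<^sub>0)\<close>.\<close>
  have \<eta>\<^sub>0: "\<eta>\<^sub>0 = \<phi> \<xi>\<^sub>0"
    using \<sigma>_f[of "hat \<xi>\<^sub>0"] by (simp flip: assms(9))
  have gf: "has_hat_derivative I (\<psi> \<circ> \<phi>) (g \<circ> f) \<xi>\<^sub>0 (\<beta> * \<alpha>)"
    using has_hat_derivative_comp[OF assms(1,7) f] g assms(12,13) by (simp add: \<eta>\<^sub>0)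
  have "hat_deriv I (\<psi> \<circ> \<phi>) (g \<circ> f) x = hat_deriv J \<psi> g (f x) * hat_deriv I \<phi> f x"
    if "x \<in> monad (hat \<xi>\<^sub>0)" for x
  proof -
    \<comment> \<open>A derivative at a point is determined by the limit of that point, so all three
      derivatives reduce to those at \<open>\<xi>\<^sub>0\<close> and
      \<open>\<eta>\<^sub>0\<close>.\<close>
    have "\<sigma> x = \<xi>\<^sub>0" "\<sigma> (f x) = \<eta>\<^sub>0"
      using that \<sigma>_f by (simp_all add: mem_monad_hat \<eta>\<^sub>0)
    then show ?thesis
      using f g gf by (simp add: hat_deriv_eqI)
  qed
  with gf show ?thesis
    by (auto simp: hat_differentiable_def)
qed

end
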